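(* Let $X,Y$ be Fréchet spaces with $X$ separable, let $X_0$ be a dense linear subspace of $X$, and for each $j\in\{1,\dots,N\}$ let $(T_{j,k})_{k\in\mathbb N}$ be a sequence in $L(X,Y)$. Suppose that: (a) $\lim_{k\to\infty}T_{j,k}x=0$ for all $x\in X_0$ and $1\le j\le N$; (b) there exists a $(d,1)$-distributionally unbounded vector $x$ for $((T_{j,k})_{k\in\mathbb N})_{1\le j\le N}$. Then there exists a dense uniformly $(d,1)$-distributionally irregular manifold for the sequence $((T_{j,k})_{k\in\mathbb N})_{1\le j\le N}$, and in particular $((T_{j,k})_{k\in\mathbb N})_{1\le j\le N}$ is densely $(d,1)$-distributionally chaotic.
   Context: $X,Y$ are non-trivial Fréchet spaces over the same field $\mathbb K\in\{\mathbb R,\mathbb C\}$; the topology of $Y$ is induced by an increasing fundamental system of seminorms $(p_n^Y)_{n\in\mathbb N}$ and $d_Y(x,y)=\sum_{n\ge1}2^{-n}\frac{p_n^Y(x-y)}{1+p_n^Y(x-y)}$; if $Y$ is a Banach space, $d_Y(x,y)=\|x-y\|_Y$ and $p_m^Y$ is replaced by $\|\cdot\|_Y$ below. $L(X,Y)$ is the space of continuous linear operators from $X$ to $Y$. $N\ge2$. For $D\subseteq\mathbb N$, $\overline{dens}(D)=\limsup_{n\to\infty}\frac{card(D\cap[1,n])}{n}$. For $0\ne x\in X$ and $m\in\mathbb N$: $x$ is $(d,1)$-distributionally near to $0$ iff there exists $A\subseteq\mathbb N$ with $\overline{dens}(A)=1$ and $\lim_{k\in A,k\to\infty}T_{j,k}x=0$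 for all $1\le j\le N$; $x$ is $(d,1)$-distributionally $m$-unbounded iff there exists $B\subseteq\mathbb N$ with $\overline{dens}(B)=1$ and $\lim_{k\in B,k\to\infty}p_m^Y(T_{j,k}x)=\infty$ for all $1\le j\le N$; $x$ is $(d,1)$-distributionally unbounded iff it is $(d,1)$-distributionally $m$-unbounded for some $m\in\mathbb N$. A linear manifold (linear subspace) $\{0\}\ne X'\subseteq X$ is a uniformly $(d,1)$-distributionally irregular manifold iff there exists $m\in\mathbb N$ such that every $x\in X'\setminus\{0\}$ is both $(d,1)$-distributionally $m$-unbounded and $(d,1)$-distributionally near to $0$; it is dense if it is dense in $X$. $((T_{j,k})_k)_j$ is densely $(d,1)$-distributionally chaotic iff there exist an uncountable set $S$ dense in $X$ and $\sigma>0$ such that for each $\epsilon>0$ and each pair $x,y\in S$ of distinct points, $\overline{dens}\big(\bigcap_{1\le j\le N}\{k:d_Y(T_{j,k}x,T_{j,k}y)\ge\sigma\}\big)=1$ and $\overline{dens}\big(\bigcap_{1\le j\le N}\{k:d_Y(T_{j,k}x,T_{j,k}y)<\epsilon\}\big)=1$. *)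

theory Defs
  imports "HOL-Analysis.Analysis"
begin

text \<open>
  The scalar field \<open>\<K> \<in> {\<real>, \<complex>}\<close> is a type of class \<^class>\<open>real_normed_field\<close>.  Its norm is
  multiplicative, so by Gelfand--Mazur the types of this class are, up to isometric isomorphism,
  exactly \<^typ>\<open>real\<close> and \<^typ>\<open>complex\<close>.

  Seminorms are indexed from 0, so \<open>p n\<close> is the \<open>(n + 1)\<close>-st seminorm of the usual enumeration
  \<open>p\<^sub>1 \<le> p\<^sub>2 \<le> \<dots>\<close>.  The index \<open>k\<close> of the operators \<open>T j k\<close> runs over \<open>k \<ge> 1\<close>; the value at
  \<open>k = 0\<close> is unconstrained and affects neither upper densities nor limits.
\<close>

definition seminorm_topology :: "(nat \<Rightarrow> 'a::ab_group_add \<Rightarrow> real) \<Rightarrow> 'a topology" where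
  "seminorm_topology p = topology_generated_by {{y. p n (y - x) < e} | n x e. e > 0}"

locale frechet_space = vector_space scale
  for scale :: "'k::real_normed_field \<Rightarrow> 'a::ab_group_add \<Rightarrow> 'a" +
  fixes p :: "nat \<Rightarrow> 'a \<Rightarrow> real"
  assumes seminorm_triangle: "p n (x + y) \<le> p n x + p n y"
    and seminorm_scale: "p n (scale c x) = norm c * p n x"
    and seminorm_incr: "p n x \<le> p (Suc n) x"
    and seminorm_separating: "(\<And>n. p n x = 0) \<Longrightarrow> x = 0"
    and seminorm_complete:
      "(\<And>n e. e > 0 \<Longrightarrow> \<exists>M. \<forall>i\<ge>M. \<forall>j\<ge>M. p n (s i - s j) < e) \<Longrightarrow>
        \<exists>l. limitin (seminorm_topology p) s l sequentially"

definition seminorm_dist :: "(nat \<Rightarrow> 'a::ab_group_add \<Rightarrow> real) \<Rightarrow> 'a \<Rightarrow> 'a \<Rightarrow> real" where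
  "seminorm_dist p x y = (\<Sum>n. (1/2) ^ Suc n * (p n (x - y) / (1 + p n (x - y))))"

text \<open>
  The second alternative is the Banach space convention: a Banach space is a Frechet space whose
  seminorms are all equal to one and the same (then necessarily complete) norm \<open>q\<close>, and in that case
  the distance is \<open>q (x - y)\<close>.
\<close>

definition standard_dist ::
  "(nat \<Rightarrow> 'a::ab_group_add \<Rightarrow> real) \<Rightarrow> ('a \<Rightarrow> 'a \<Rightarrow> real) \<Rightarrow> bool" where
  "standard_dist p d \<longleftrightarrow>
     d = seminorm_dist p \<or> (\<exists>q. p = (\<lambda>_. q) \<and> d = (\<lambda>x y. q (x - y)))"

definition continuous_linear_operators ::
  "('k::real_normed_field \<Rightarrow> 'x::ab_group_add \<Rightarrow> 'x) \<Rightarrow> (nat \<Rightarrow> 'x \<Rightarrow> real) \<Rightarrow>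
   ('k \<Rightarrow> 'y::ab_group_add \<Rightarrow> 'y) \<Rightarrow> (nat \<Rightarrow> 'y \<Rightarrow> real) \<Rightarrow> ('x \<Rightarrow> 'y) set" where
  "continuous_linear_operators sX pX sY pY =
     {f. Vector_Spaces.linear sX sY f \<and>
         continuous_map (seminorm_topology pX) (seminorm_topology pY) f}"

definition dense_in :: "'a topology \<Rightarrow> 'a set \<Rightarrow> bool" where
  "dense_in X D \<longleftrightarrow> D \<subseteq> topspace X \<and> X closure_of D = topspace X"

definition upper_density :: "nat set \<Rightarrow> ereal" where
  "upper_density D = limsup (\<lambda>n. ereal (real (card (D \<inter> {1..n})) / real n))"

definition along :: "nat set \<Rightarrow> nat filter" where
  "along A = inf sequentially (principal A)"

definition distr_near_zero ::
  "(nat \<Rightarrow> 'y::ab_group_add \<Rightarrow> real) \<Rightarrow> nat \<Rightarrow> (nat \<Rightarrow> nat \<Rightarrow> 'x::ab_group_add \<Rightarrow> 'y) \<Rightarrow> 'x \<Rightarrow> bool" where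
  "distr_near_zero pY N T x \<longleftrightarrow> x \<noteq> 0 \<and>
     (\<exists>A. upper_density A = 1 \<and>
       (\<forall>j\<in>{1..N}. limitin (seminorm_topology pY) (\<lambda>k. T j k x) 0 (along A)))"

definition distr_m_unbounded ::
  "(nat \<Rightarrow> 'y::ab_group_add \<Rightarrow> real) \<Rightarrow> nat \<Rightarrow> (nat \<Rightarrow> nat \<Rightarrow> 'x::ab_group_add \<Rightarrow> 'y) \<Rightarrow>
   nat \<Rightarrow> 'x \<Rightarrow> bool" where
  "distr_m_unbounded pY N T m x \<longleftrightarrow> x \<noteq> 0 \<and>
     (\<exists>B. upper_density B = 1 \<and>
       (\<forall>j\<in>{1..N}. filterlim (\<lambda>k. pY m (T j k x)) at_top (along B)))"

definition distr_unbounded ::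
  "(nat \<Rightarrow> 'y::ab_group_add \<Rightarrow> real) \<Rightarrow> nat \<Rightarrow> (nat \<Rightarrow> nat \<Rightarrow> 'x::ab_group_add \<Rightarrow> 'y) \<Rightarrow> 'x \<Rightarrow> bool" where
  "distr_unbounded pY N T x \<longleftrightarrow> (\<exists>m. distr_m_unbounded pY N T m x)"

definition uniformly_distr_irregular_manifold ::
  "('k::real_normed_field \<Rightarrow> 'x::ab_group_add \<Rightarrow> 'x) \<Rightarrow> (nat \<Rightarrow> 'y::ab_group_add \<Rightarrow> real) \<Rightarrow>
   nat \<Rightarrow> (nat \<Rightarrow> nat \<Rightarrow> 'x \<Rightarrow> 'y) \<Rightarrow> 'x set \<Rightarrow> bool" where
  "uniformly_distr_irregular_manifold sX pY N T M \<longleftrightarrow>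
     module.subspace sX M \<and> M \<noteq> {0} \<and>
     (\<exists>m. \<forall>x\<in>M - {0}. distr_m_unbounded pY N T m x \<and> distr_near_zero pY N T x)"

definition densely_distr_chaotic ::
  "(nat \<Rightarrow> 'x::ab_group_add \<Rightarrow> real) \<Rightarrow> ('y \<Rightarrow> 'y \<Rightarrow> real) \<Rightarrow> nat \<Rightarrow> (nat \<Rightarrow> nat \<Rightarrow> 'x \<Rightarrow> 'y) \<Rightarrow> bool" where
  "densely_distr_chaotic pX dY N T \<longleftrightarrow>
     (\<exists>S \<sigma>. uncountable S \<and> dense_in (seminorm_topology pX) S \<and> \<sigma> > 0 \<and>
       (\<forall>\<epsilon>>0. \<forall>x\<in>S. \<forall>y\<in>S. x \<noteq> y \<longrightarrow>
         upper_density (\<Inter>j\<in>{1..N}. {k. dY (T j k x) (T j k y) \<ge> \<sigma>}) = 1 \<and>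
         upper_density (\<Inter>j\<in>{1..N}. {k. dY (T j k x) (T j k y) < \<epsilon>}) = 1))"

end

theory Submission
  imports Defs
begin

text \<open>
  The manifold is spanned by vectors of the form ``element of \<open>X0\<close> plus a small lacunary series''.
  The elements of \<open>X0\<close> provide density and are harmless, because their orbits tend to zero; the
  series provide the irregular behaviour.

  The series are made of vectors \<open>y\<^sub>0, y\<^sub>1, \<dots>\<close> and blocks of times \<open>G\<^sub>r \<subseteq> {1..n\<^sub>r}\<close> that fill at
  least the proportion \<open>1 - 1/(r+1)\<close> of \<open>{1..n\<^sub>r}\<close>.  At the times in \<open>G\<^sub>r\<close> all \<open>N\<close> operators give
  \<open>y\<^sub>r\<close> an image with \<open>m\<close>-th seminorm at least \<open>r\<close>, whereas the \<open>r\<close>-th seminorm of the images of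
  every other \<open>y\<^sub>s\<close> is at most \<open>2\<^sup>-\<^sup>r 2\<^sup>-\<^sup>s\<close>.  Such vectors are chosen one after the other
  (\<open>next_block\<close>): a small multiple of the given unbounded vector has small images up to any time
  fixed before, and is large at most times up to some later \<open>n\<^sub>r\<close>; by continuity of the finitely many
  operators up to \<open>n\<^sub>r\<close>, a vector \<open>y\<^sub>r\<close> of the dense subspace \<open>X0\<close> inherits this.  As \<open>y\<^sub>r\<close> lies in
  \<open>X0\<close>, its images tend to zero, hence are small in most of the later blocks.

  For a set \<open>S\<close> of indices the series of the \<open>y\<^sub>s\<close> with \<open>s \<in> S\<close> is thus large on \<open>G\<^sub>r\<close> for
  \<open>r \<in> S\<close> and small on \<open>G\<^sub>r\<close> for \<open>r \<notin> S\<close> (\<open>series_on_block\<close>), and a union of infinitely many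
  blocks has upper density one.  Infinitely many disjoint infinite index sets are used for the
  generators, and one more is kept in reserve.  In a nonzero element of the span some generator has a
  nonzero coefficient; along the blocks of its index set the element is unbounded
  (\<open>combination_unbounded\<close>), and along the reserved blocks its orbit tends to zero
  (\<open>combination_near_zero\<close>).  The seminorm \<open>m\<close> is that of the given vector, so it is uniform.

  Differences of points of the manifold lie in the manifold, and the manifold is uncountable; this
  makes it a scrambled set for dense distributional chaos.
\<close>

section \<open>Sets of upper density one\<close>

text \<open>
  The proportions never exceed one, so upper density one is a lower bound on the limes superior; the
  quantified form makes it possible to choose, beyond any given time, an initial segment that is as
  full as desired.
\<close>

lemma upper_density_eq_1_iff:
  "upper_density D = 1 \<longleftrightarrow>
     (\<forall>c<1. \<forall>L. \<exists>n>L. c * real n \<le> real (card (D \<inter> {1..n})))"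
proof -
  let ?q = "\<lambda>n. ereal (real (card (D \<inter> {1..n})) / real n)"
  have "card (D \<inter> {1..n}) \<le> n" for n
    using card_mono[of "{1..n}" "D \<inter> {1..n}"] by simp
  then have "?q n \<le> 1" for n
    by (cases "n = 0") (auto simp: divide_le_eq)
  then have le: "upper_density D \<le> 1"
    unfolding upper_density_def by (intro Limsup_bounded) auto
  show ?thesis
  proof (intro iffI allI impI)
    fix c :: real and L :: nat
    assume D: "upper_density D = 1" and c: "c < 1"
    show "\<exists>n>L. c * real n \<le> real (card (D \<inter> {1..n}))"
    proof (rule ccontr)
      assume "\<not> (\<exists>n>L. c * real n \<le> real (card (D \<inter> {1..n})))"
      then have lt: "real (card (D \<inter> {1..n})) < c * real n" if "n > L" for n
        using that by (metis not_less)
      have "?q n \<le> ereal c" if "n \<ge> Suc L" for n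
        using lt[of n] that by (auto simp: divide_le_eq)
      then have "eventually (\<lambda>n. ?q n \<le> ereal c) sequentially"
        using eventually_sequentially by blast
      then have "upper_density D \<le> ereal c"
        unfolding upper_density_def by (rule Limsup_bounded)
      with D c show False by (simp add: one_ereal_def)
    qed
  next
    assume R: "\<forall>c<1. \<forall>L. \<exists>n>L. c * real n \<le> real (card (D \<inter> {1..n}))"
    show "upper_density D = 1"
    proof (rule ccontr)
      assume "upper_density D \<noteq> 1"
      with le have "upper_density D < ereal 1" by (simp add: one_ereal_def)
      then obtain c where c: "upper_density D < ereal c" "ereal c < ereal 1"
        using ereal_dense2 by blast
      have "eventually (\<lambda>n. ?q n < ereal c) sequentially"
        using c(1) unfolding upper_density_def by (rule Limsup_lessD)
      then obtain L where L: "\<And>n. n \<ge> L \<Longrightarrow> ?q n < ereal c"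
        unfolding eventually_sequentially by blast
      from c(2) have "c < 1" by simp
      with R obtain n where n: "n > L" "c * real n \<le> real (card (D \<inter> {1..n}))" by blast
      with L[of n] show False by (auto simp: divide_less_eq)
    qed
  qed
qed

text \<open>
  A set that contains \<open>A\<close> from \<open>K\<close> on loses at most \<open>K\<close> elements compared with \<open>A\<close>.  This is
  negligible in long segments if the proportion demanded of \<open>A\<close> is raised slightly.
\<close>

lemma upper_density_1_eventually_superset:
  assumes A: "upper_density A = 1" and AD: "\<And>k. k \<ge> K \<Longrightarrow> k \<in> A \<Longrightarrow> k \<in> D"
  shows "upper_density D = 1"
  unfolding upper_density_eq_1_iff
proof (intro allI impI)
  fix c :: real and L :: nat
  assume c: "c < 1"
  define c' where "c' = (1 + c) / 2"
  have c': "c' < 1" "c < c'" using c by (auto simp: c'_def)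
  obtain n where n: "n > max L (nat \<lceil>real K / (c' - c)\<rceil>)"
    "c' * real n \<le> real (card (A \<inter> {1..n}))"
    using A c'(1) unfolding upper_density_eq_1_iff by blast
  have "A \<inter> {1..n} \<subseteq> (D \<inter> {1..n}) \<union> {..<K}"
    using AD by (auto simp: not_less)
  then have "card (A \<inter> {1..n}) \<le> card ((D \<inter> {1..n}) \<union> {..<K})"
    by (intro card_mono) auto
  also have "\<dots> \<le> card (D \<inter> {1..n}) + K"
    using card_Un_le[of "D \<inter> {1..n}" "{..<K}"] by simp
  finally have le: "real (card (A \<inter> {1..n})) \<le> real (card (D \<inter> {1..n})) + real K"
    by linarith
  have "real K / (c' - c) \<le> real n" using n(1) by linarith
  then have "real K \<le> (c' - c) * real n"
    using c'(2) by (simp add: pos_divide_le_eq mult.commute)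
  with n(2) le have "c * real n \<le> real (card (D \<inter> {1..n}))"
    by (simp add: algebra_simps)
  with n(1) show "\<exists>n>L. c * real n \<le> real (card (D \<inter> {1..n}))" by auto
qed

lemma eventually_along:
  "eventually P (along A) \<longleftrightarrow> (\<exists>K. \<forall>k\<ge>K. k \<in> A \<longrightarrow> P k)"
  by (simp add: along_def eventually_inf_principal eventually_sequentially)

lemma upper_density_1_if_eventually_along:
  assumes "upper_density A = 1" and "eventually (\<lambda>k. k \<in> D) (along A)"
  shows "upper_density D = 1"
  using assms(2) upper_density_1_eventually_superset[OF assms(1)]
  unfolding eventually_along by blast

text \<open>
  The next two lemmas turn statements about blocks of times into statements about upper density and
  limits: infinitely many blocks, each filling almost all of its initial segment, suffice for upper
  density one, and a late time can only lie in a block of large index.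
\<close>

lemma upper_density_UN_blocks:
  fixes n :: "nat \<Rightarrow> nat"
  assumes n: "strict_mono n" and R: "infinite R"
    and sub: "\<And>r. G r \<subseteq> {1..n r}"
    and card: "\<And>r. (1 - 1 / (real r + 1)) * real (n r) \<le> real (card (G r))"
  shows "upper_density (\<Union>r\<in>R. G r) = 1"
  unfolding upper_density_eq_1_iff
proof (intro allI impI)
  fix c :: real and L :: nat
  assume c: "c < 1"
  obtain r where r: "r \<in> R" "r > max L (nat \<lceil>1 / (1 - c)\<rceil>)"
    using R unfolding infinite_nat_iff_unbounded by blast
  have "1 / (1 - c) \<le> real r + 1" using r(2) by linarith
  then have "1 / (real r + 1) \<le> 1 - c"
    using c by (simp add: field_simps)
  then have "c * real (n r) \<le> (1 - 1 / (real r + 1)) * real (n r)"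
    by (intro mult_right_mono) auto
  also have "\<dots> \<le> real (card (G r))" by (rule card)
  also have "\<dots> \<le> real (card ((\<Union>r\<in>R. G r) \<inter> {1..n r}))"
    using r(1) sub[of r] by (intro of_nat_mono card_mono) auto
  finally have "c * real (n r) \<le> real (card ((\<Union>r\<in>R. G r) \<inter> {1..n r}))" .
  moreover have "n r > L" using strict_mono_imp_increasing[OF n, of r] r(2) by simp
  ultimately show "\<exists>n>L. c * real n \<le> real (card ((\<Union>r\<in>R. G r) \<inter> {1..n}))" by blast
qed

lemma eventually_along_UN_blocks:
  fixes n :: "nat \<Rightarrow> nat"
  assumes n: "strict_mono n" and sub: "\<And>r. G r \<subseteq> {1..n r}"
    and P: "\<And>r i. r \<ge> r0 \<Longrightarrow> r \<in> R \<Longrightarrow> i \<in> G r \<Longrightarrow> P i"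
  shows "eventually P (along (\<Union>r\<in>R. G r))"
  unfolding eventually_along
proof (intro exI allI impI)
  fix i assume i: "i \<ge> Suc (n r0)" "i \<in> (\<Union>r\<in>R. G r)"
  then obtain r where r: "r \<in> R" "i \<in> G r" by blast
  with sub[of r] have "i \<le> n r" by auto
  with i(1) have "n r0 < n r" by simp
  then have "r \<ge> r0" using strict_mono_less[OF n] by simp
  with P r show "P i" by blast
qed

section \<open>Seminorms and their topology\<close>

context frechet_space
begin

lemma p_zero [simp]: "p n 0 = 0"
  using seminorm_scale[of n 0 0] by simp

lemma p_minus [simp]: "p n (- x) = p n x"
  using seminorm_scale[of n "-1" x] by simp

lemma p_nonneg [simp]: "0 \<le> p n x"
  using seminorm_triangle[of n x "- x"] by simp

lemma p_minus_commute: "p n (x - y) = p n (y - x)"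
  using p_minus[of n "x - y"] by simp

lemma p_mono: "m \<le> n \<Longrightarrow> p m x \<le> p n x"
  by (rule lift_Suc_mono_le[of "\<lambda>n. p n x"]) (rule seminorm_incr)

lemma p_sum: "p n (sum f A) \<le> (\<Sum>a\<in>A. p n (f a))"
proof (induction A rule: infinite_finite_induct)
  case (insert a A)
  then show ?case
    using seminorm_triangle[of n "f a" "sum f A"] by simp
qed simp_all

lemma p_dist_triangle: "p n (x - z) \<le> p n (x - y) + p n (y - z)"
  using seminorm_triangle[of n "x - y" "y - z"] by simp

lemma p_diff_le: "p n x - p n y \<le> p n (x - y)"
  using seminorm_triangle[of n "x - y" y] by simp

lemma p_add_ge: "p n x - p n y \<le> p n (x + y)"
  using p_diff_le[of n x "- y"] by simp

lemma p_of_real: "p n (scale (of_real t) x) = \<bar>t\<bar> * p n x"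
  by (simp add: seminorm_scale)

lemma openin_ball: "e > 0 \<Longrightarrow> openin (seminorm_topology p) {y. p n (y - x) < e}"
  unfolding seminorm_topology_def openin_topology_generated_by_iff
  by (intro generate_topology_on.Basis) blast

text \<open>
  The generating balls form a base, not merely a subbase, because the seminorms increase: of two
  balls around a point, one with the larger index and the smaller radius lies in both.
\<close>

lemma openin_seminorm_topology_iff:
  "openin (seminorm_topology p) U \<longleftrightarrow> (\<forall>x\<in>U. \<exists>n e. e > 0 \<and> {y. p n (y - x) < e} \<subseteq> U)"
proof
  assume "openin (seminorm_topology p) U"
  then have "generate_topology_on {{y. p n (y - x) < e} | n x e. e > 0} U"
    by (simp add: seminorm_topology_def openin_topology_generated_by_iff)
  then show "\<forall>x\<in>U. \<exists>n e. e > 0 \<and> {y. p n (y - x) < e} \<subseteq> U"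
  proof induction
    case Empty
    then show ?case by simp
  next
    case (Int a b)
    show ?case
    proof
      fix x assume "x \<in> a \<inter> b"
      with Int.IH obtain n e m d where
        *: "e > 0" "{y. p n (y - x) < e} \<subseteq> a" "d > 0" "{y. p m (y - x) < d} \<subseteq> b"
        by (meson IntD1 IntD2)
      have "{y. p (max n m) (y - x) < min e d} \<subseteq> a \<inter> b"
      proof
        fix y assume "y \<in> {y. p (max n m) (y - x) < min e d}"
        then have "p n (y - x) < e" "p m (y - x) < d"
          using p_mono[of n "max n m" "y - x"] p_mono[of m "max n m" "y - x"] by auto
        with * show "y \<in> a \<inter> b" by auto
      qed
      with * show "\<exists>n e. e > 0 \<and> {y. p n (y - x) < e} \<subseteq> a \<inter> b"
        by (metis min_less_iff_conj)
    qed
  next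
    case (UN K)
    then show ?case by (meson Sup_upper UnionE order_trans)
  next
    case (Basis s)
    then obtain n x e where s: "s = {y. p n (y - x) < e}" by blast
    show ?case
    proof
      fix z assume z: "z \<in> s"
      have "{y. p n (y - z) < e - p n (z - x)} \<subseteq> s"
      proof
        fix y assume "y \<in> {y. p n (y - z) < e - p n (z - x)}"
        with p_dist_triangle[of n y x z] show "y \<in> s"
          unfolding s by simp
      qed
      moreover have "e - p n (z - x) > 0" using z s by simp
      ultimately show "\<exists>n e. e > 0 \<and> {y. p n (y - z) < e} \<subseteq> s" by blast
    qed
  qed
next
  assume U: "\<forall>x\<in>U. \<exists>n e. e > 0 \<and> {y. p n (y - x) < e} \<subseteq> U"
  have "\<exists>V. openin (seminorm_topology p) V \<and> x \<in> V \<and> V \<subseteq> U" if x: "x \<in> U" for x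
  proof -
    obtain n e where "e > 0" "{y. p n (y - x) < e} \<subseteq> U" using U x by blast
    then show ?thesis using openin_ball by (intro exI[of _ "{y. p n (y - x) < e}"]) auto
  qed
  then show "openin (seminorm_topology p) U"
    by (subst openin_subopen) blast
qed

lemma topspace_seminorm_topology [simp]: "topspace (seminorm_topology p) = UNIV"
proof -
  have "openin (seminorm_topology p) UNIV"
    unfolding openin_seminorm_topology_iff using zero_less_one by blast
  then show ?thesis using openin_subset by fastforce
qed

lemma limitin_seminorm_iff:
  "limitin (seminorm_topology p) f l F \<longleftrightarrow> (\<forall>n. \<forall>e>0. eventually (\<lambda>k. p n (f k - l) < e) F)"
proof
  assume L: "limitin (seminorm_topology p) f l F"
  show "\<forall>n. \<forall>e>0. eventually (\<lambda>k. p n (f k - l) < e) F"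
  proof (intro allI impI)
    fix n :: nat and e :: real
    assume "e > 0"
    then show "eventually (\<lambda>k. p n (f k - l) < e) F"
      using L openin_ball[of e n l] unfolding limitin_def by auto
  qed
next
  assume R: "\<forall>n. \<forall>e>0. eventually (\<lambda>k. p n (f k - l) < e) F"
  show "limitin (seminorm_topology p) f l F"
    unfolding limitin_def
  proof (intro conjI allI impI)
    fix U assume "openin (seminorm_topology p) U \<and> l \<in> U"
    then obtain n e where "e > 0" "{y. p n (y - l) < e} \<subseteq> U"
      unfolding openin_seminorm_topology_iff by blast
    with R have "eventually (\<lambda>k. p n (f k - l) < e) F" by blast
    then show "eventually (\<lambda>k. f k \<in> U) F"
      by (rule eventually_mono) (use \<open>{y. p n (y - l) < e} \<subseteq> U\<close> in blast)
  qed simp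
qed

lemma dense_in_seminorm_iff:
  "dense_in (seminorm_topology p) D \<longleftrightarrow> (\<forall>x n. \<forall>e>0. \<exists>v\<in>D. p n (v - x) < e)"
proof
  assume D: "dense_in (seminorm_topology p) D"
  show "\<forall>x n. \<forall>e>0. \<exists>v\<in>D. p n (v - x) < e"
  proof (intro allI impI)
    fix x n and e :: real
    assume e: "e > 0"
    have "x \<in> seminorm_topology p closure_of D"
      using D by (simp add: dense_in_def)
    then have "\<exists>v. v \<in> D \<and> v \<in> {y. p n (y - x) < e}"
      using openin_ball[OF e, of n x] e unfolding in_closure_of
      by (elim conjE allE[of _ "{y. p n (y - x) < e}"]) simp
    then show "\<exists>v\<in>D. p n (v - x) < e" by (simp add: Bex_def)
  qed
next
  assume R: "\<forall>x n. \<forall>e>0. \<exists>v\<in>D. p n (v - x) < e"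
  have "x \<in> seminorm_topology p closure_of D" for x
    unfolding in_closure_of
  proof (intro conjI allI impI)
    fix U assume "x \<in> U \<and> openin (seminorm_topology p) U"
    then obtain n e where "e > 0" "{y. p n (y - x) < e} \<subseteq> U"
      unfolding openin_seminorm_topology_iff by blast
    moreover obtain v where "v \<in> D" "p n (v - x) < e" using R \<open>e > 0\<close> by blast
    ultimately show "\<exists>y. y \<in> D \<and> y \<in> U" by blast
  qed simp
  then show "dense_in (seminorm_topology p) D"
    by (auto simp: dense_in_def)
qed

lemma p_limit_le:
  assumes "limitin (seminorm_topology p) f l sequentially"
    and "eventually (\<lambda>i. p n (f i - a) \<le> c) sequentially"
  shows "p n (l - a) \<le> c"
proof (rule field_le_epsilon)
  fix e :: real assume "e > 0"
  with assms(1) have "eventually (\<lambda>i. p n (f i - l) < e) sequentially"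
    unfolding limitin_seminorm_iff by blast
  with assms(2) have "eventually (\<lambda>i. p n (f i - a) \<le> c \<and> p n (f i - l) < e) sequentially"
    by (rule eventually_conj)
  then obtain i where "p n (f i - a) \<le> c" "p n (f i - l) < e"
    unfolding eventually_sequentially by blast
  then show "p n (l - a) \<le> c + e"
    using p_dist_triangle[of n l a "f i"] p_minus_commute[of n l "f i"] by linarith
qed

text \<open>
  Since \<open>p n \<le> p s\<close> for \<open>s \<ge> n\<close>, the hypothesis makes the series absolutely convergent for every
  seminorm, although it bounds each term in one seminorm only.
\<close>

lemma dyadic_series_converges:
  assumes f: "\<And>s. p s (f s) \<le> (1/2) ^ s"
  shows "\<exists>l. limitin (seminorm_topology p) (\<lambda>i. \<Sum>s<i. f s) l sequentially"
proof (rule seminorm_complete)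
  fix n :: nat and e :: real
  assume e: "e > 0"
  have "Cauchy (\<lambda>i. \<Sum>s<i. (1/2::real) ^ s)"
    by (intro convergent_Cauchy) (simp add: summable_iff_convergent[symmetric] summable_geometric)
  then obtain K where K: "\<And>i j. i \<ge> K \<Longrightarrow> j \<ge> K \<Longrightarrow>
      dist (\<Sum>s<i. (1/2::real) ^ s) (\<Sum>s<j. (1/2) ^ s) < e"
    using e unfolding Cauchy_def by blast
  have le: "p n ((\<Sum>s<i. f s) - (\<Sum>s<j. f s)) < e" if ij: "max K n \<le> j" "j \<le> i" for i j
  proof -
    have "{..<i} = {..<j} \<union> {j..<i}" using ij by auto
    then have split: "(\<Sum>s<i. g s) = (\<Sum>s<j. g s) + (\<Sum>s=j..<i. g s)" for g :: "nat \<Rightarrow> 'z::comm_monoid_add"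
      by (simp add: sum.union_disjoint[symmetric] ivl_disj_int)
    have "p n ((\<Sum>s<i. f s) - (\<Sum>s<j. f s)) = p n (\<Sum>s=j..<i. f s)"
      by (simp add: split[of f])
    also have "\<dots> \<le> (\<Sum>s=j..<i. p n (f s))" by (rule p_sum)
    also have "\<dots> \<le> (\<Sum>s=j..<i. (1/2) ^ s)"
    proof (rule sum_mono)
      fix s assume "s \<in> {j..<i}"
      then have "p n (f s) \<le> p s (f s)" using ij by (intro p_mono) auto
      with f[of s] show "p n (f s) \<le> (1/2) ^ s" by linarith
    qed
    also have "\<dots> = (\<Sum>s<i. (1/2) ^ s) - (\<Sum>s<j. (1/2) ^ s)"
      by (simp add: split)
    also have "\<dots> < e" using K[of i j] ij by (auto simp: dist_real_def)
    finally show ?thesis .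
  qed
  show "\<exists>M. \<forall>i\<ge>M. \<forall>j\<ge>M. p n ((\<Sum>s<i. f s) - (\<Sum>s<j. f s)) < e"
  proof (intro exI allI impI)
    fix i j assume "max K n \<le> i" "max K n \<le> j"
    then show "p n ((\<Sum>s<i. f s) - (\<Sum>s<j. f s)) < e"
      using le[of i j] le[of j i] p_minus_commute by (metis nat_le_linear)
  qed
qed

end

section \<open>Series built from well separated blocks\<close>

locale operator_family = X: frechet_space sX pX + Y: frechet_space sY pY
  for sX :: "'k::real_normed_field \<Rightarrow> 'x::ab_group_add \<Rightarrow> 'x" and pX :: "nat \<Rightarrow> 'x \<Rightarrow> real"
    and sY :: "'k \<Rightarrow> 'y::ab_group_add \<Rightarrow> 'y" and pY :: "nat \<Rightarrow> 'y \<Rightarrow> real" +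
  fixes N :: nat and T :: "nat \<Rightarrow> nat \<Rightarrow> 'x \<Rightarrow> 'y"
  assumes T_operator:
    "j \<in> {1..N} \<Longrightarrow> k \<ge> 1 \<Longrightarrow> T j k \<in> continuous_linear_operators sX pX sY pY"
begin

lemma T_hom: "j \<in> {1..N} \<Longrightarrow> k \<ge> 1 \<Longrightarrow> module_hom sX sY (T j k)"
  using T_operator[of j k]
  by (simp add: continuous_linear_operators_def Vector_Spaces.linear_def)

lemmas T_add = module_hom.add[OF T_hom]
  and T_diff = module_hom.diff[OF T_hom]
  and T_scale = module_hom.scale[OF T_hom]
  and T_sum = module_hom.sum[OF T_hom]
  and T_zero = module_hom.zero[OF T_hom]

lemma T_limit:
  assumes "j \<in> {1..N}" "k \<ge> 1" "limitin (seminorm_topology pX) f l F"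
  shows "limitin (seminorm_topology pY) (\<lambda>i. T j k (f i)) (T j k l) F"
  using continuous_map_limit[of "seminorm_topology pX" "seminorm_topology pY" "T j k" f l F]
    assms T_operator[of j k]
  by (simp add: continuous_linear_operators_def o_def)

text \<open>
  Equicontinuity of finitely many of the operators: for each of them the ball in question pulls
  back to a neighbourhood of the origin, and finitely many seminorm balls around the origin contain
  a common one.
\<close>

lemma T_equicontinuous:
  assumes e: "e > 0"
  shows "\<exists>M d. d > 0 \<and> (\<forall>v. pX M v < d \<longrightarrow> (\<forall>j\<in>{1..N}. \<forall>i\<in>{1..L}. pY r (T j i v) < e))"
proof -
  have "\<exists>M d. d > 0 \<and> (\<forall>v. pX M v < d \<longrightarrow> (\<forall>(j, i)\<in>P. pY r (T j i v) < e))"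
    if "finite P" "P \<subseteq> {1..N} \<times> {1..L}" for P
    using that
  proof (induction P rule: finite_induct)
    case empty
    then show ?case by (auto intro: exI[of _ 1])
  next
    case (insert ji P)
    obtain j i where ji: "ji = (j, i)" by (cases ji)
    with insert.prems have j: "j \<in> {1..N}" "i \<ge> 1" by auto
    obtain M d where Md: "d > 0" "\<And>v. pX M v < d \<Longrightarrow> \<forall>(j, i)\<in>P. pY r (T j i v) < e"
      using insert.IH insert.prems by blast
    let ?U = "{v. T j i v \<in> {w. pY r (w - 0) < e}}"
    have "continuous_map (seminorm_topology pX) (seminorm_topology pY) (T j i)"
      using T_operator[OF j] by (simp add: continuous_linear_operators_def)
    from openin_continuous_map_preimage[OF this Y.openin_ball[OF e, of r 0]]
    have "openin (seminorm_topology pX) ?U" by simp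
    moreover have "0 \<in> ?U" using e by (simp add: T_zero[OF j])
    ultimately obtain M' d' where M'd': "d' > 0" "{v. pX M' (v - 0) < d'} \<subseteq> ?U"
      unfolding X.openin_seminorm_topology_iff by blast
    have "\<forall>(j, i)\<in>insert ji P. pY r (T j i v) < e" if v: "pX (max M M') v < min d d'" for v
    proof -
      have "pX M v < d" "pX M' v < d'"
        using v X.p_mono[of M "max M M'" v] X.p_mono[of M' "max M M'" v] by auto
      then show ?thesis using Md(2)[of v] M'd'(2) by (auto simp: ji)
    qed
    then show ?case using Md(1) M'd'(1)
      by (intro exI[of _ "max M M'"] exI[of _ "min d d'"]) auto
  qed
  from this[of "{1..N} \<times> {1..L}"] show ?thesis by auto
qed

end

text \<open>
  Vectors \<open>y r\<close> with disjoint roles: on the block of times \<open>G r\<close>, which fills almost all of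
  \<open>{1..n r}\<close>, the vector \<open>y r\<close> has large images, while every other \<open>y s\<close> has small images, so
  small that they can be summed over \<open>s\<close>.  For \<open>s < r\<close> this will hold because the orbit of \<open>y s\<close>
  has already decayed, for \<open>s > r\<close> because \<open>y s\<close> is still tiny.
\<close>

locale block_sequence = operator_family sX pX sY pY N T
  for sX :: "'k::real_normed_field \<Rightarrow> 'x::ab_group_add \<Rightarrow> 'x" and pX
    and sY :: "'k \<Rightarrow> 'y::ab_group_add \<Rightarrow> 'y" and pY N T +
  fixes m :: nat and y :: "nat \<Rightarrow> 'x" and n :: "nat \<Rightarrow> nat" and G :: "nat \<Rightarrow> nat set"
  assumes n_strict_mono: "strict_mono n"
    and G_subset: "G r \<subseteq> {1..n r}"
    and G_card: "(1 - 1 / (real r + 1)) * real (n r) \<le> real (card (G r))"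
    and y_small: "pX s (y s) \<le> (1/2) ^ s"
    and y_large_on_own_block: "i \<in> G r \<Longrightarrow> j \<in> {1..N} \<Longrightarrow> real r \<le> pY m (T j i (y r))"
    and y_small_on_other_blocks:
      "i \<in> G r \<Longrightarrow> j \<in> {1..N} \<Longrightarrow> s \<noteq> r \<Longrightarrow> pY r (T j i (y s)) \<le> (1/2) ^ r * (1/2) ^ s"
begin

definition series :: "nat set \<Rightarrow> 'x" where
  "series S = (SOME u. limitin (seminorm_topology pX) (\<lambda>i. \<Sum>s<i. if s \<in> S then y s else 0) u sequentially)"

lemma series_limit:
  "limitin (seminorm_topology pX) (\<lambda>i. \<Sum>s<i. if s \<in> S then y s else 0) (series S) sequentially"
  unfolding series_def
  by (rule someI_ex, rule X.dyadic_series_converges) (use y_small in auto)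

lemma sum_half_powers_le: "finite A \<Longrightarrow> (\<Sum>s\<in>A. (1/2::real) ^ s) \<le> 2"
  using sum_le_suminf[of "\<lambda>s. (1/2::real) ^ s" A] by (simp add: suminf_geometric)

lemma series_small:
  assumes S: "S \<subseteq> {k..}" and "l \<le> k"
  shows "pX l (series S) \<le> 2 * (1/2) ^ k"
proof -
  have "pX l (\<Sum>s<i. if s \<in> S then y s else 0) \<le> 2 * (1/2) ^ k" for i
  proof -
    have "pX l (\<Sum>s<i. if s \<in> S then y s else 0) \<le> (\<Sum>s<i. pX l (if s \<in> S then y s else 0))"
      by (rule X.p_sum)
    also have "\<dots> \<le> (\<Sum>s<i. if k \<le> s then (1/2) ^ s else 0)"
    proof (rule sum_mono)
      fix s
      have "pX l (y s) \<le> (1/2) ^ s" if "k \<le> s"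
        using X.p_mono[of l s "y s"] y_small[of s] that \<open>l \<le> k\<close> by linarith
      then show "pX l (if s \<in> S then y s else 0) \<le> (if k \<le> s then (1/2) ^ s else 0)"
        using S by auto
    qed
    also have "\<dots> = (\<Sum>s\<in>{k..<i}. (1/2) ^ s)"
      by (rule sum.mono_neutral_cong_right) auto
    also have "\<dots> = (\<Sum>s\<in>{0..<i - k}. (1/2) ^ k * (1/2) ^ s)"
      by (rule sum.reindex_bij_witness[of _ "\<lambda>s. s + k" "\<lambda>s. s - k"]) (auto simp flip: power_add)
    also have "\<dots> = (1/2) ^ k * (\<Sum>s\<in>{0..<i - k}. (1/2) ^ s)"
      by (simp add: sum_distrib_left)
    also have "\<dots> \<le> (1/2) ^ k * 2"
      by (intro mult_left_mono sum_half_powers_le) auto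
    finally show ?thesis by (simp add: mult.commute)
  qed
  then show ?thesis
    using X.p_limit_le[OF series_limit[of S], where a = 0 and n = l] by simp
qed

text \<open>
  On the block \<open>G r\<close> only the term of index \<open>r\<close> matters: the geometric bounds on the images of the
  others add up, and they survive the passage to the limit because the operators are continuous.
\<close>

lemma series_on_block:
  assumes i: "i \<in> G r" and j: "j \<in> {1..N}"
  shows "pY r (T j i (series S - (if r \<in> S then y r else 0))) \<le> 2 * (1/2) ^ r"
proof -
  have i1: "i \<ge> 1" using i G_subset[of r] by auto
  let ?f = "\<lambda>s. if s \<in> S then y s else 0"
  have part: "pY r (T j i (\<Sum>s<q. ?f s) - T j i (?f r)) \<le> 2 * (1/2) ^ r" if q: "q > r" for q
  proof -
    have "T j i (\<Sum>s<q. ?f s) - T j i (?f r) = T j i (\<Sum>s\<in>{..<q} - {r}. ?f s)"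
      unfolding T_diff[OF j i1, symmetric] using q
      by (subst sum.remove[of "{..<q}" r]) auto
    also have "\<dots> = (\<Sum>s\<in>{..<q} - {r}. T j i (?f s))"
      by (rule T_sum[OF j i1])
    also have "pY r \<dots> \<le> (\<Sum>s\<in>{..<q} - {r}. pY r (T j i (?f s)))"
      by (rule Y.p_sum)
    also have "\<dots> \<le> (\<Sum>s\<in>{..<q} - {r}. (1/2) ^ r * (1/2) ^ s)"
      using y_small_on_other_blocks[OF i j] by (intro sum_mono) (auto simp: T_zero[OF j i1])
    also have "\<dots> \<le> (1/2) ^ r * 2"
      unfolding sum_distrib_left[symmetric] by (intro mult_left_mono sum_half_powers_le) auto
    finally show ?thesis by (simp add: mult.commute)
  qed
  have "eventually (\<lambda>q. pY r (T j i (\<Sum>s<q. ?f s) - T j i (?f r)) \<le> 2 * (1/2) ^ r) sequentially"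
    using part by (intro eventually_sequentiallyI[of "Suc r"]) auto
  with T_limit[OF j i1 series_limit[of S]]
  have "pY r (T j i (series S) - T j i (?f r)) \<le> 2 * (1/2) ^ r"
    by (rule Y.p_limit_le)
  then show ?thesis by (simp add: T_diff[OF j i1])
qed

lemma combination_on_block:
  assumes i: "i \<in> G r" and j: "j \<in> {1..N}"
  shows "pY r (T j i (\<Sum>k\<in>F. sX (a k) (series (S k))) -
               (\<Sum>k\<in>F. sY (a k) (T j i (if r \<in> S k then y r else 0))))
         \<le> (\<Sum>k\<in>F. norm (a k)) * (2 * (1/2) ^ r)"
proof -
  have i1: "i \<ge> 1" using i G_subset[of r] by auto
  have "T j i (\<Sum>k\<in>F. sX (a k) (series (S k))) -
          (\<Sum>k\<in>F. sY (a k) (T j i (if r \<in> S k then y r else 0)))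
      = (\<Sum>k\<in>F. sY (a k) (T j i (series (S k) - (if r \<in> S k then y r else 0))))"
    by (simp only: T_sum[OF j i1] T_scale[OF j i1] T_diff[OF j i1] sum_subtractf[symmetric]
        Y.scale_right_diff_distrib)
  also have "pY r \<dots> \<le> (\<Sum>k\<in>F. pY r (sY (a k) (T j i (series (S k) - (if r \<in> S k then y r else 0)))))"
    by (rule Y.p_sum)
  also have "\<dots> \<le> (\<Sum>k\<in>F. norm (a k) * (2 * (1/2) ^ r))"
    unfolding Y.seminorm_scale
    by (intro sum_mono mult_left_mono series_on_block[OF i j]) auto
  finally show ?thesis by (simp add: sum_distrib_right)
qed

lemma residual_tendsto_0: "(\<lambda>r. A * (2 * (1/2) ^ r)) \<longlonglongrightarrow> (0::real)"
proof -
  have "(\<lambda>r. (1/2::real) ^ r) \<longlonglongrightarrow> 0" by (rule LIMSEQ_power_zero) simp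
  from tendsto_mult_left[OF this, of "A * 2"] show ?thesis by (simp add: mult.assoc)
qed

text \<open>
  A combination of series none of which uses the indices in \<open>R\<close> is invisible on the blocks with
  index in \<open>R\<close>.
\<close>

lemma combination_near_zero:
  assumes R: "\<And>k. k \<in> F \<Longrightarrow> S k \<inter> R = {}"
    and z: "\<And>j. j \<in> {1..N} \<Longrightarrow> limitin (seminorm_topology pY) (\<lambda>k. T j k z) 0 sequentially"
    and j: "j \<in> {1..N}"
  shows "limitin (seminorm_topology pY)
           (\<lambda>i. T j i (z + (\<Sum>k\<in>F. sX (a k) (series (S k))))) 0 (along (\<Union>r\<in>R. G r))"
  unfolding Y.limitin_seminorm_iff
proof (intro allI impI)
  fix l :: nat and e :: real
  assume e: "e > 0"
  let ?v = "\<Sum>k\<in>F. sX (a k) (series (S k))"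
  let ?A = "\<Sum>k\<in>F. norm (a k)"
  have "eventually (\<lambda>k. pY l (T j k z - 0) < e / 2) sequentially"
    using z[OF j] e half_gt_zero unfolding Y.limitin_seminorm_iff by blast
  then obtain K where K: "\<And>i. i \<ge> K \<Longrightarrow> pY l (T j i z) < e / 2"
    unfolding eventually_sequentially by auto
  have "eventually (\<lambda>r. ?A * (2 * (1/2) ^ r) < e / 2) sequentially"
    using order_tendstoD(2)[OF residual_tendsto_0[of ?A], of "e / 2"] e by simp
  then obtain r0 where r0: "\<And>r. r \<ge> r0 \<Longrightarrow> ?A * (2 * (1/2) ^ r) < e / 2"
    unfolding eventually_sequentially by blast
  have "eventually (\<lambda>i. pY l (T j i ?v) < e / 2) (along (\<Union>r\<in>R. G r))"
  proof (rule eventually_along_UN_blocks[OF n_strict_mono G_subset])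
    fix r i assume r: "max l r0 \<le> r" "r \<in> R" "i \<in> G r"
    then have i1: "i \<ge> 1" using G_subset[of r] by auto
    have "(\<Sum>k\<in>F. sY (a k) (T j i (if r \<in> S k then y r else 0))) = 0"
      using R r(2) by (intro sum.neutral) (auto simp: T_zero[OF j i1])
    then have "pY r (T j i ?v) \<le> ?A * (2 * (1/2) ^ r)"
      using combination_on_block[OF r(3) j, where F = F and a = a and S = S] by simp
    with r0[of r] Y.p_mono[of l r "T j i ?v"] r(1) show "pY l (T j i ?v) < e / 2" by simp
  qed
  then obtain K' where K': "\<And>i. i \<ge> K' \<Longrightarrow> i \<in> (\<Union>r\<in>R. G r) \<Longrightarrow> pY l (T j i ?v) < e / 2"
    unfolding eventually_along by blast
  have "pY l (T j i (z + ?v) - 0) < e" if i: "i \<ge> max 1 (max K K')" "i \<in> (\<Union>r\<in>R. G r)" for i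
  proof -
    have "T j i (z + ?v) = T j i z + T j i ?v" using i by (intro T_add[OF j]) simp
    then show ?thesis
      using Y.seminorm_triangle[of l "T j i z" "T j i ?v"] K[of i] K'[of i] i by simp
  qed
  then show "eventually (\<lambda>i. pY l (T j i (z + ?v) - 0) < e) (along (\<Union>r\<in>R. G r))"
    unfolding eventually_along by blast
qed

text \<open>
  If \<open>r\<close> is an index of exactly one of the series, then on \<open>G r\<close> the combination is governed by the
  corresponding multiple of \<open>y r\<close>.
\<close>

lemma combination_unbounded:
  assumes F: "finite F" "h \<in> F" "a h \<noteq> 0"
    and S: "\<And>k. k \<in> F \<Longrightarrow> k \<noteq> h \<Longrightarrow> S k \<inter> S h = {}"
    and z: "\<And>j. j \<in> {1..N} \<Longrightarrow> limitin (seminorm_topology pY) (\<lambda>k. T j k z) 0 sequentially"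
    and j: "j \<in> {1..N}"
  shows "filterlim (\<lambda>i. pY m (T j i (z + (\<Sum>k\<in>F. sX (a k) (series (S k)))))) at_top
           (along (\<Union>r\<in>S h. G r))"
  unfolding filterlim_at_top
proof
  fix C :: real
  let ?v = "\<Sum>k\<in>F. sX (a k) (series (S k))"
  let ?A = "\<Sum>k\<in>F. norm (a k)"
  have "eventually (\<lambda>k. pY m (T j k z - 0) < 1) sequentially"
    using z[OF j] zero_less_one unfolding Y.limitin_seminorm_iff by blast
  then obtain K where K: "\<And>i. i \<ge> K \<Longrightarrow> pY m (T j i z) < 1"
    unfolding eventually_sequentially by auto
  have "eventually (\<lambda>r. ?A * (2 * (1/2) ^ r) < 1) sequentially"
    using order_tendstoD(2)[OF residual_tendsto_0[of ?A], of 1] by simp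
  then obtain r0 where r0: "\<And>r. r \<ge> r0 \<Longrightarrow> ?A * (2 * (1/2) ^ r) < 1"
    unfolding eventually_sequentially by blast
  \<comment> \<open>from \<open>r1\<close> on, the main term \<open>a h\<close> times \<open>y r\<close> has images beyond \<open>C + 2\<close>: one unit is lost to the
     remaining terms, and one to \<open>z\<close>\<close>
  define r1 where "r1 = nat \<lceil>(C + 2) / norm (a h)\<rceil>"
  have "eventually (\<lambda>i. pY m (T j i ?v) \<ge> C + 1) (along (\<Union>r\<in>S h. G r))"
  proof (rule eventually_along_UN_blocks[OF n_strict_mono G_subset])
    fix r i assume r: "max m (max r0 r1) \<le> r" "r \<in> S h" "i \<in> G r"
    then have i1: "i \<ge> 1" using G_subset[of r] by auto
    have "(\<Sum>k\<in>F. sY (a k) (T j i (if r \<in> S k then y r else 0)))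
        = (\<Sum>k\<in>{h}. sY (a k) (T j i (if r \<in> S k then y r else 0)))"
      using F S r(2) by (intro sum.mono_neutral_right) (auto simp: T_zero[OF j i1])
    also have "\<dots> = sY (a h) (T j i (y r))" using r(2) by simp
    finally have "pY r (T j i ?v - sY (a h) (T j i (y r))) \<le> ?A * (2 * (1/2) ^ r)"
      using combination_on_block[OF r(3) j, where F = F and a = a and S = S] by simp
    then have "pY m (sY (a h) (T j i (y r)) - T j i ?v) < 1"
      using r0[of r] r(1) Y.p_mono[of m r "T j i ?v - sY (a h) (T j i (y r))"]
        Y.p_minus_commute[of m "T j i ?v"] by simp
    moreover have "pY m (sY (a h) (T j i (y r))) \<ge> C + 2"
    proof -
      have "(C + 2) / norm (a h) \<le> real r" using r(1) unfolding r1_def by linarith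
      then have "C + 2 \<le> norm (a h) * real r"
        using F(3) by (simp add: pos_divide_le_eq mult.commute)
      also have "\<dots> \<le> norm (a h) * pY m (T j i (y r))"
        by (intro mult_left_mono y_large_on_own_block[OF r(3) j]) auto
      finally show ?thesis by (simp add: Y.seminorm_scale)
    qed
    ultimately show "pY m (T j i ?v) \<ge> C + 1"
      using Y.p_diff_le[of m "sY (a h) (T j i (y r))" "T j i ?v"] by linarith
  qed
  then obtain K' where K': "\<And>i. i \<ge> K' \<Longrightarrow> i \<in> (\<Union>r\<in>S h. G r) \<Longrightarrow> pY m (T j i ?v) \<ge> C + 1"
    unfolding eventually_along by blast
  have "C \<le> pY m (T j i (z + ?v))" if i: "i \<ge> max 1 (max K K')" "i \<in> (\<Union>r\<in>S h. G r)" for i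
  proof -
    have "T j i (z + ?v) = T j i ?v + T j i z"
      using i by (subst T_add[OF j]) (simp_all add: add.commute)
    then show ?thesis
      using Y.p_add_ge[of m "T j i ?v" "T j i z"] K[of i] K'[of i] i by simp
  qed
  then show "eventually (\<lambda>i. C \<le> pY m (T j i (z + ?v))) (along (\<Union>r\<in>S h. G r))"
    unfolding eventually_along by blast
qed

lemma upper_density_blocks: "infinite R \<Longrightarrow> upper_density (\<Union>r\<in>R. G r) = 1"
  by (rule upper_density_UN_blocks[OF n_strict_mono _ G_subset G_card])

end

section \<open>Existence of the blocks\<close>

context operator_family
begin

text \<open>
  One step of the construction.  A small multiple of the unbounded vector \<open>x\<close> is just as unbounded,
  and it has small images up to any given time \<open>L\<close>.  Beyond \<open>L\<close> there is a time \<open>n\<close> such that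
  almost all of \<open>{1..n}\<close> consists of times at which the multiple is large and the previous vectors
  have decayed.  Only finitely many operators count up to time \<open>n\<close>, so a vector of the dense
  subspace can take the place of the multiple.
\<close>

lemma next_block:
  assumes x: "distr_m_unbounded pY N T m x"
    and dense: "dense_in (seminorm_topology pX) X0"
    and decay: "\<And>v j. v \<in> X0 \<Longrightarrow> j \<in> {1..N} \<Longrightarrow>
                  limitin (seminorm_topology pY) (\<lambda>k. T j k v) 0 sequentially"
    and F: "finite F" "F \<subseteq> X0" and e: "e > 0"
  shows "\<exists>y n. y \<in> X0 \<and> n > L \<and> pX r y < e \<and>
    (\<forall>j\<in>{1..N}. \<forall>i\<in>{1..L}. pY r (T j i y) < e) \<and>
    (1 - 1 / (real r + 1)) * real n
      \<le> real (card {i \<in> {1..n}. \<forall>j\<in>{1..N}. real r \<le> pY m (T j i y) \<and> (\<forall>v\<in>F. pY r (T j i v) < e)})"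
proof -
  obtain B where B: "upper_density B = 1"
    "\<And>j. j \<in> {1..N} \<Longrightarrow> filterlim (\<lambda>k. pY m (T j k x)) at_top (along B)"
    using x unfolding distr_m_unbounded_def by blast
  obtain M d where Md: "d > 0"
    "\<And>v. pX M v < d \<Longrightarrow> \<forall>j\<in>{1..N}. \<forall>i\<in>{1..L}. pY r (T j i v) < e / 2"
    using T_equicontinuous[of "e / 2" L r] e by auto
  define d' where "d' = min d (e / 2)"
  have d': "d' > 0" using Md(1) e by (simp add: d'_def)
  \<comment> \<open>scaling factor that brings \<open>x\<close> into the ball of radius \<open>d'\<close>; the \<open>1\<close> avoids dividing by zero\<close>
  define t where "t = d' / (2 * (1 + pX (max M r) x))"
  have pos: "1 + pX (max M r) x > 0" by (simp add: add_pos_nonneg)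
  have t: "t > 0" unfolding t_def using d' pos by simp
  define u where "u = sX (of_real t) x"
  have "q < 2 * (1 + q)" if "q \<ge> 0" for q :: real
    using that by simp
  from this[OF X.p_nonneg] have "t * pX (max M r) x < t * (2 * (1 + pX (max M r) x))"
    using t by (rule mult_strict_left_mono)
  also have "\<dots> = d'" unfolding t_def using pos by (simp add: field_simps)
  finally have u: "pX (max M r) u < d'" using t by (simp add: u_def X.p_of_real)
  then have u_small: "pX r u < e / 2" "pX M u < d"
    using X.p_mono[of r "max M r" u] X.p_mono[of M "max M r" u] by (auto simp: d'_def)

  \<comment> \<open>one unit more than required, to be lost when \<open>u\<close> is replaced by a vector of \<open>X0\<close>\<close>
  define D where "D = {i. \<forall>j\<in>{1..N}. real r + 1 \<le> pY m (T j i u) \<and> (\<forall>v\<in>F. pY r (T j i v) < e)}"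
  have large: "eventually (\<lambda>i. real r + 1 \<le> pY m (T j i u)) (along B)" if j: "j \<in> {1..N}" for j
  proof -
    have "eventually (\<lambda>i. (real r + 1) / t \<le> pY m (T j i x)) (along B)"
      using B(2)[OF j] unfolding filterlim_at_top by blast
    then obtain K where K: "\<And>i. i \<ge> K \<Longrightarrow> i \<in> B \<Longrightarrow> (real r + 1) / t \<le> pY m (T j i x)"
      unfolding eventually_along by blast
    have "real r + 1 \<le> pY m (T j i u)" if i: "i \<ge> max 1 K" "i \<in> B" for i
    proof -
      have "pY m (T j i u) = t * pY m (T j i x)"
        using i t unfolding u_def by (subst T_scale[OF j]) (simp_all add: Y.p_of_real)
      then show ?thesis using K[of i] i t by (simp add: pos_divide_le_eq mult.commute)
    qed
    then show ?thesis unfolding eventually_along by blast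
  qed
  have small: "eventually (\<lambda>i. pY r (T j i v) < e) (along B)" if "j \<in> {1..N}" "v \<in> F" for j v
  proof -
    have "limitin (seminorm_topology pY) (\<lambda>k. T j k v) 0 sequentially"
      using decay that F(2) by blast
    then have "eventually (\<lambda>k. pY r (T j k v - 0) < e) sequentially"
      using e unfolding Y.limitin_seminorm_iff by blast
    then show ?thesis
      unfolding eventually_along eventually_sequentially by simp blast
  qed
  have "eventually (\<lambda>i. i \<in> D) (along B)"
    unfolding D_def mem_Collect_eq
    using large small F(1) by (intro eventually_ball_finite ballI eventually_conj) auto
  with B(1) have "upper_density D = 1" by (rule upper_density_1_if_eventually_along)
  moreover have "1 - 1 / (real r + 1) < 1" by simp
  ultimately obtain n where n: "n > L"
    "(1 - 1 / (real r + 1)) * real n \<le> real (card (D \<inter> {1..n}))"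
    unfolding upper_density_eq_1_iff by blast

  obtain M' c where Mc: "c > 0"
    "\<And>v. pX M' v < c \<Longrightarrow> \<forall>j\<in>{1..N}. \<forall>i\<in>{1..n}. pY m (T j i v) < 1"
    using T_equicontinuous[of 1 n m] by auto
  obtain y where y: "y \<in> X0" "pX (max M' (max M r)) (y - u) < min c (d' - pX (max M r) u)"
    using dense Mc(1) u unfolding X.dense_in_seminorm_iff
    by (meson diff_gt_0_iff_gt min_less_iff_conj)
  have y_u: "pX M' (y - u) < c" "pX (max M r) (y - u) < d' - pX (max M r) u"
    using y(2) X.p_mono[of M' "max M' (max M r)" "y - u"]
      X.p_mono[of "max M r" "max M' (max M r)" "y - u"] by auto
  have "pX (max M r) y < d'"
    using y_u(2) X.p_diff_le[of "max M r" y u] by linarith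
  then have y_small: "pX r y < e / 2" "pX M y < d"
    using X.p_mono[of r "max M r" y] X.p_mono[of M "max M r" y] by (auto simp: d'_def)
  have close: "real r \<le> pY m (T j i y)"
    if j: "j \<in> {1..N}" and i: "i \<in> {1..n}" and D: "real r + 1 \<le> pY m (T j i u)" for i j
  proof -
    have "pY m (T j i u - T j i y) < 1"
    proof -
      have "pY m (T j i (y - u)) < 1" using Mc(2)[OF y_u(1)] j i by blast
      moreover have "T j i (y - u) = T j i y - T j i u" using i by (intro T_diff[OF j]) simp
      ultimately show ?thesis using Y.p_minus_commute[of m "T j i u" "T j i y"] by simp
    qed
    then show ?thesis
      using D Y.p_diff_le[of m "T j i u" "T j i y"] by linarith
  qed
  show ?thesis
  proof (intro exI conjI ballI)
    show "pX r y < e" using y_small(1) e by linarith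
    show "pY r (T j i y) < e" if "j \<in> {1..N}" "i \<in> {1..L}" for j i
      using Md(2)[OF y_small(2)] that e by force
    have "D \<inter> {1..n} \<subseteq> {i \<in> {1..n}. \<forall>j\<in>{1..N}. real r \<le> pY m (T j i y) \<and> (\<forall>v\<in>F. pY r (T j i v) < e)}"
      using close unfolding D_def by auto
    then have "card (D \<inter> {1..n})
        \<le> card {i \<in> {1..n}. \<forall>j\<in>{1..N}. real r \<le> pY m (T j i y) \<and> (\<forall>v\<in>F. pY r (T j i v) < e)}"
      by (intro card_mono) auto
    with n(2) show "(1 - 1 / (real r + 1)) * real n
        \<le> real (card {i \<in> {1..n}. \<forall>j\<in>{1..N}. real r \<le> pY m (T j i y) \<and> (\<forall>v\<in>F. pY r (T j i v) < e)})"
      by linarith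
  qed (use y(1) n(1) in auto)
qed

text \<open>
  Iterating the step requires dependent choice on states that remember the vectors chosen so far.
  The tolerance \<open>(1/4) ^ r\<close> at step \<open>r\<close> is at most \<open>(1/2) ^ r * (1/2) ^ s\<close> for all \<open>s \<le> r\<close>, which
  is the bound on block \<open>r\<close> for the earlier vectors; for a later vector the bound comes from the
  tolerance of its own step, since the seminorms increase.
\<close>

lemma block_sequence_exists:
  assumes x: "distr_m_unbounded pY N T m x"
    and dense: "dense_in (seminorm_topology pX) X0"
    and decay: "\<And>v j. v \<in> X0 \<Longrightarrow> j \<in> {1..N} \<Longrightarrow>
                  limitin (seminorm_topology pY) (\<lambda>k. T j k v) 0 sequentially"
  obtains y n G where "block_sequence sX pX sY pY N T m y n G"
proof -
  define e :: "nat \<Rightarrow> real" where "e r = (1/4) ^ r" for r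
  have e: "e r > 0" for r by (simp add: e_def)
  define H where "H r F y n =
      {i \<in> {1..n}. \<forall>j\<in>{1..N}. real r \<le> pY m (T j i y) \<and> (\<forall>v\<in>F. pY r (T j i v) < e r)}"
    for r :: nat and F :: "'x set" and y :: 'x and n :: nat
  \<comment> \<open>A state \<open>(F, L, y, n)\<close> carries the set \<open>F\<close> of the previous vectors and the previous time \<open>L\<close>.\<close>
  define P where "P r = (\<lambda>(F, L, y, n).
      finite F \<and> F \<subseteq> X0 \<and> y \<in> X0 \<and> n > L \<and> pX r y < e r \<and>
      (\<forall>j\<in>{1..N}. \<forall>i\<in>{1..L}. pY r (T j i y) < e r) \<and>
      (1 - 1 / (real r + 1)) * real n \<le> real (card (H r F y n)))" for r :: nat
  define Q where "Q = (\<lambda>(F, _ :: nat, y, n) (F', L', _ :: 'x, _ :: nat). F' = insert (y :: 'x) F \<and> L' = (n :: nat))"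
  have step: "\<exists>y n. P r (F, L, y, n)" if F: "finite F" "F \<subseteq> X0" for r F L
    unfolding P_def H_def prod.case using next_block[OF x dense decay F e, of L r r] F by simp
  have "\<exists>f. \<forall>r. P r (f r) \<and> Q (f r) (f (Suc r))"
  proof (rule dependent_nat_choice)
    show "\<exists>st. P 0 st" using step[of "{}"] by blast
  next
    fix st r assume P: "P r st"
    obtain F L y n where st: "st = (F, L, y, n)" by (cases st)
    have "finite (insert y F)" "insert y F \<subseteq> X0" using P by (auto simp: P_def st)
    from step[OF this] obtain y' n' where "P (Suc r) (insert y F, n, y', n')" by blast
    then show "\<exists>st'. P (Suc r) st' \<and> Q st st'" by (auto simp: Q_def st)
  qed
  then obtain f where f: "\<And>r. P r (f r)" "\<And>r. Q (f r) (f (Suc r))" by blast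
  define F where "F r = fst (f r)" for r
  define L where "L r = fst (snd (f r))" for r
  define y where "y r = fst (snd (snd (f r)))" for r
  define n where "n r = snd (snd (snd (f r)))" for r
  have f_eq: "f r = (F r, L r, y r, n r)" for r
    by (simp add: F_def L_def y_def n_def)
  have PF: "n r > L r" "pX r (y r) < e r"
    "\<And>j i. j \<in> {1..N} \<Longrightarrow> i \<in> {1..L r} \<Longrightarrow> pY r (T j i (y r)) < e r"
    "(1 - 1 / (real r + 1)) * real (n r) \<le> real (card (H r (F r) (y r) (n r)))" for r
    using f(1)[of r] by (auto simp: P_def f_eq)
  have QF: "F (Suc r) = insert (y r) (F r)" "L (Suc r) = n r" for r
    using f(2)[of r] by (auto simp: Q_def f_eq)
  have n_mono: "strict_mono n"
    using PF(1) QF(2) by (metis strict_monoI_Suc)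
  have F: "y s \<in> F r" if "s < r" for s r
    using that by (induction r) (auto simp: QF(1) less_Suc_eq)
  have e_le: "e q \<le> (1/2) ^ r * (1/2) ^ s" if "r \<le> q" "s \<le> q" for q r s
  proof -
    have "e q = (1/2) ^ q * (1/2) ^ q"
      by (simp add: e_def flip: power_mult_distrib)
    also have "\<dots> \<le> (1/2) ^ r * (1/2) ^ s"
      using that by (intro mult_mono power_decreasing) auto
    finally show ?thesis .
  qed
  have "block_sequence sX pX sY pY N T m y n (\<lambda>r. H r (F r) (y r) (n r))"
  proof (intro block_sequence.intro operator_family_axioms block_sequence_axioms.intro n_mono PF(4))
    show "H r (F r) (y r) (n r) \<subseteq> {1..n r}" for r by (auto simp: H_def)
    show "pX s (y s) \<le> (1/2) ^ s" for s
      using PF(2)[of s] e_le[of 0 s s] by simp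
    show "real r \<le> pY m (T j i (y r))" if "i \<in> H r (F r) (y r) (n r)" "j \<in> {1..N}" for i r j
      using that by (auto simp: H_def)
    show "pY r (T j i (y s)) \<le> (1/2) ^ r * (1/2) ^ s"
      if i: "i \<in> H r (F r) (y r) (n r)" and j: "j \<in> {1..N}" and "s \<noteq> r" for i r j s
    proof (cases "s < r")
      case True
      then have "pY r (T j i (y s)) < e r" using i j F by (auto simp: H_def)
      with e_le[of r r s] True show ?thesis by simp
    next
      case False
      with \<open>s \<noteq> r\<close> have "r < s" by simp
      then obtain q where s: "s = Suc q" "r \<le> q" by (cases s) auto
      then have "i \<in> {1..L s}"
        using i QF(2)[of q] strict_mono_less_eq[OF n_mono, of r q] by (auto simp: H_def)
      then have "pY s (T j i (y s)) < e s" using PF(3) j by blast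
      with Y.p_mono[of r s "T j i (y s)"] e_le[of r s s] \<open>r < s\<close> show ?thesis by simp
    qed
  qed
  then show thesis by (rule that)
qed

end

section \<open>The irregular manifold\<close>

context block_sequence
begin

text \<open>
  The index set is split into infinitely many infinite rows.  Row \<open>Suc k\<close> is spent on the \<open>k\<close>-th
  generator of the manifold; row \<open>0\<close> is used by no generator, so that on its blocks every element of
  the manifold is close to zero.
\<close>

definition row :: "nat \<Rightarrow> nat set" where
  "row k = range (\<lambda>l. prod_encode (k, l))"

lemma infinite_row: "infinite (row k)"
  unfolding row_def by (intro range_inj_infinite) (auto intro: injI)

lemma row_disjoint: "k \<noteq> h \<Longrightarrow> row k \<inter> row h = {}"
  by (auto simp: row_def)

lemma row_subset: "row k \<subseteq> {k..}"
  using le_prod_encode_1 by (auto simp: row_def)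

text \<open>
  An element of the span is a vector of \<open>Z\<close>, whose images tend to zero, plus a combination of series
  over disjoint rows.  A nonzero coefficient, which exists as the element is not zero, makes it large
  on the blocks of the corresponding row.
\<close>

lemma span_generators_irregular:
  assumes Z: "X.subspace Z" "\<And>k. z k \<in> Z"
    and decay: "\<And>v j. v \<in> Z \<Longrightarrow> j \<in> {1..N} \<Longrightarrow>
                  limitin (seminorm_topology pY) (\<lambda>k. T j k v) 0 sequentially"
    and v: "v \<in> X.span (range (\<lambda>k. z k + series (row (Suc k))))" "v \<noteq> 0"
  shows "distr_m_unbounded pY N T m v" and "distr_near_zero pY N T v"
proof -
  let ?w = "\<lambda>k. z k + series (row (Suc k))"
  obtain t b where t: "finite t" "t \<subseteq> range ?w" "v = (\<Sum>w\<in>t. sX (b w) w)"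
    using v(1) unfolding X.span_explicit by blast
  obtain F where F: "inj_on ?w F" "t = ?w ` F"
    using t(2) unfolding subset_image_inj by blast
  have finF: "finite F" using t(1) F by (simp add: finite_image_iff)
  define a where "a k = b (?w k)" for k
  have "v = (\<Sum>k\<in>F. sX (a k) (?w k))"
    by (simp add: t(3) F(2) sum.reindex[OF F(1)] a_def)
  then have v_eq: "v = (\<Sum>k\<in>F. sX (a k) (z k)) + (\<Sum>k\<in>F. sX (a k) (series (row (Suc k))))"
    by (simp add: X.scale_right_distrib sum.distrib)
  have "\<exists>h\<in>F. a h \<noteq> 0"
  proof (rule ccontr)
    assume "\<not> (\<exists>h\<in>F. a h \<noteq> 0)"
    then have "v = 0" unfolding v_eq by simp
    with v(2) show False by simp
  qed
  then obtain h where h: "h \<in> F" "a h \<noteq> 0" by blast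
  have "(\<Sum>k\<in>F. sX (a k) (z k)) \<in> Z"
    using Z by (intro X.subspace_sum X.subspace_scale)
  then have z: "limitin (seminorm_topology pY) (\<lambda>i. T j i (\<Sum>k\<in>F. sX (a k) (z k))) 0 sequentially"
    if "j \<in> {1..N}" for j
    using decay that by blast
  show "distr_m_unbounded pY N T m v"
    unfolding distr_m_unbounded_def
  proof (intro conjI exI ballI)
    show "upper_density (\<Union>r\<in>row (Suc h). G r) = 1"
      by (rule upper_density_blocks[OF infinite_row])
    show "filterlim (\<lambda>i. pY m (T j i v)) at_top (along (\<Union>r\<in>row (Suc h). G r))"
      if "j \<in> {1..N}" for j
      unfolding v_eq
      by (rule combination_unbounded[where S = "\<lambda>k. row (Suc k)"])
        (use finF h z that row_disjoint in auto)
  qed (rule v(2))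
  show "distr_near_zero pY N T v"
    unfolding distr_near_zero_def
  proof (intro conjI exI ballI)
    show "upper_density (\<Union>r\<in>row 0. G r) = 1"
      by (rule upper_density_blocks[OF infinite_row])
    show "limitin (seminorm_topology pY) (\<lambda>i. T j i v) 0 (along (\<Union>r\<in>row 0. G r))"
      if "j \<in> {1..N}" for j
      unfolding v_eq
      by (rule combination_near_zero[where S = "\<lambda>k. row (Suc k)"])
        (use z that row_disjoint in auto)
  qed (rule v(2))
qed

text \<open>
  Density is arranged by letting the \<open>k\<close>-th generator with \<open>k = prod_encode (a, b)\<close> approximate the
  \<open>a\<close>-th point of a countable dense set with precision \<open>(1/2) ^ b\<close>; the attached series is smaller
  than that precision up to a constant.
\<close>

lemma dense_span_generators:
  assumes C: "countable C" "dense_in (seminorm_topology pX) C"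
    and Z: "dense_in (seminorm_topology pX) Z"
  obtains z where "\<And>k. z k \<in> Z"
    "dense_in (seminorm_topology pX) (X.span (range (\<lambda>k. z k + series (row (Suc k)))))"
proof -
  have "C \<noteq> {}"
    using C(2) zero_less_one unfolding X.dense_in_seminorm_iff by blast
  define g where "g a b = (SOME v. v \<in> Z \<and> pX b (v - from_nat_into C a) < (1/2) ^ b)" for a b
  have g: "g a b \<in> Z" "pX b (g a b - from_nat_into C a) < (1/2) ^ b" for a b
  proof -
    have "(0::real) < (1/2) ^ b" by simp
    then have "\<exists>v. v \<in> Z \<and> pX b (v - from_nat_into C a) < (1/2) ^ b"
      using Z unfolding X.dense_in_seminorm_iff by blast
    then have "g a b \<in> Z \<and> pX b (g a b - from_nat_into C a) < (1/2) ^ b"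
      unfolding g_def by (rule someI_ex)
    then show "g a b \<in> Z" "pX b (g a b - from_nat_into C a) < (1/2) ^ b" by simp_all
  qed
  define z where "z k = (case prod_decode k of (a, b) \<Rightarrow> g a b)" for k
  let ?w = "\<lambda>k. z k + series (row (Suc k))"
  have "dense_in (seminorm_topology pX) (X.span (range ?w))"
    unfolding X.dense_in_seminorm_iff
  proof (intro allI impI)
    fix x l and e :: real
    assume e: "e > 0"
    obtain c where c: "c \<in> C" "pX l (c - x) < e / 2"
      using C(2) e half_gt_zero unfolding X.dense_in_seminorm_iff by blast
    obtain a where a: "c = from_nat_into C a"
      using from_nat_into_surj[OF C(1) c(1)] by metis
    have "eventually (\<lambda>b. 3 / 2 * (2 * (1/2) ^ b) < e / 2) sequentially"
      using order_tendstoD(2)[OF residual_tendsto_0[of "3/2"], of "e / 2"] e by simp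
    then obtain b0 where b0: "\<And>b. b \<ge> b0 \<Longrightarrow> 3 / 2 * (2 * (1/2) ^ b) < e / 2"
      unfolding eventually_sequentially by blast
    define b where "b = max b0 l"
    define k where "k = prod_encode (a, b)"
    have bk: "b \<le> Suc k" using le_prod_encode_2[of b a] by (simp add: k_def)
    have "pX b (series (row (Suc k))) \<le> 2 * (1/2) ^ Suc k"
      by (rule series_small[OF row_subset bk])
    also have "\<dots> \<le> 2 * (1/2) ^ b"
      using bk by (intro mult_left_mono power_decreasing) auto
    finally have s: "pX b (series (row (Suc k))) \<le> 2 * (1/2) ^ b" .
    have "pX b (?w k - c) \<le> pX b (g a b - c) + pX b (series (row (Suc k)))"
      using X.seminorm_triangle[of b "g a b - c" "series (row (Suc k))"]
      by (simp add: z_def k_def algebra_simps)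
    also have "\<dots> < e / 2"
      using s g(2)[of b a] b0[of b] by (simp add: a b_def)
    finally have "pX l (?w k - c) < e / 2"
      using X.p_mono[of l b "?w k - c"] by (simp add: b_def)
    with c(2) have "pX l (?w k - x) < e"
      using X.p_dist_triangle[of l "?w k" x c] by linarith
    then show "\<exists>v\<in>X.span (range ?w). pX l (v - x) < e"
      by (intro bexI[of _ "?w k"] X.span_base) auto
  qed
  moreover have "z k \<in> Z" for k by (auto simp: z_def g(1) split: prod.split)
  ultimately show thesis by (rule that[rotated])
qed

end

section \<open>From irregular manifolds to scrambled sets\<close>

context frechet_space
begin

lemma seminorm_dist_term_bounds:
  "0 \<le> (1/2) ^ Suc n * (p n x / (1 + p n x))" "(1/2) ^ Suc n * (p n x / (1 + p n x)) \<le> (1/2) ^ Suc n"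
proof -
  have "0 < 1 + p n x" using p_nonneg[of n x] by linarith
  then have *: "0 \<le> p n x / (1 + p n x)" "p n x / (1 + p n x) \<le> 1"
    by simp_all
  show "0 \<le> (1/2) ^ Suc n * (p n x / (1 + p n x))"
    using *(1) by (intro mult_nonneg_nonneg) auto
  show "(1/2) ^ Suc n * (p n x / (1 + p n x)) \<le> (1/2) ^ Suc n"
    using *(2) by (intro mult_left_le) auto
qed

lemma summable_half_powers_Suc: "summable (\<lambda>n. (1/2::real) ^ Suc n)"
  unfolding summable_Suc_iff by (rule summable_geometric) simp

lemma summable_seminorm_dist: "summable (\<lambda>n. (1/2) ^ Suc n * (p n x / (1 + p n x)))"
  by (rule summable_comparison_test'[OF summable_half_powers_Suc, of 0])
    (use seminorm_dist_term_bounds in auto)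

text \<open>
  A lower bound on one seminorm bounds the distance from below by the corresponding single term.
\<close>

lemma standard_dist_ge:
  assumes "standard_dist p d" and "p m (x - y) \<ge> 1"
  shows "d x y \<ge> (1/2) ^ (m + 2)"
proof -
  consider "d = seminorm_dist p" | q where "p = (\<lambda>_. q)" "d = (\<lambda>x y. q (x - y))"
    using assms(1) unfolding standard_dist_def by blast
  then show ?thesis
  proof cases
    case 1
    have "1/2 \<le> p m (x - y) / (1 + p m (x - y))"
      using assms(2) by (simp add: field_simps)
    then have "(1/2) ^ Suc m * (1/2) \<le> (1/2) ^ Suc m * (p m (x - y) / (1 + p m (x - y)))"
      by (intro mult_left_mono) auto
    also have "\<dots> \<le> seminorm_dist p x y"
      unfolding seminorm_dist_def
      using sum_le_suminf[OF summable_seminorm_dist, of "{m}" "x - y"] seminorm_dist_term_bounds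
      by simp
    finally show ?thesis by (simp add: 1)
  next
    case 2
    have "(1/2::real) ^ (m + 2) \<le> 1" by (rule power_le_one) auto
    with 2 assms(2) show ?thesis by simp
  qed
qed

text \<open>
  Conversely, the terms beyond some index contribute little in any case, and the finitely many
  others are controlled by the largest seminorm involved.
\<close>

lemma standard_dist_less:
  assumes "standard_dist p d" and e: "e > 0"
  obtains n c where "c > 0" "\<And>x y. p n (x - y) < c \<Longrightarrow> d x y < e"
proof -
  consider "d = seminorm_dist p" | q where "p = (\<lambda>_. q)" "d = (\<lambda>x y. q (x - y))"
    using assms(1) unfolding standard_dist_def by blast
  then show thesis
  proof cases
    case 1
    have "(\<lambda>n. (1/2::real) ^ n) \<longlonglongrightarrow> 0" by (rule LIMSEQ_power_zero) simp
    from order_tendstoD(2)[OF this, of "e / 2"] e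
    obtain n where n: "(1/2::real) ^ n < e / 2"
      unfolding eventually_sequentially by auto
    have "d x y < e" if small: "p n (x - y) < e / 2" for x y
    proof -
      let ?t = "\<lambda>k. (1/2) ^ Suc k * (p k (x - y) / (1 + p k (x - y)))"
      have geo: "(\<lambda>k. (1/2::real) ^ Suc k) sums 1"
        using power_half_series by simp
      have split: "?t k \<le> (1/2) ^ Suc k * p n (x - y) + (1/2) ^ n * (if n \<le> k then (1/2) ^ Suc (k - n) else 0)"
        for k
      proof (cases "n \<le> k")
        case True
        then have "(1/2::real) ^ n * (1/2) ^ Suc (k - n) = (1/2) ^ Suc k"
          by (simp flip: power_add)
        with True seminorm_dist_term_bounds(2)[of k "x - y"] show ?thesis
          using p_nonneg[of n "x - y"] by (simp add: add_increasing)
      next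
        case False
        have "p k (x - y) / (1 + p k (x - y)) \<le> p k (x - y) / 1"
          by (rule divide_left_mono) (auto simp: add_pos_nonneg)
        also have "\<dots> \<le> p n (x - y)" using False by (simp add: p_mono)
        finally have "?t k \<le> (1/2) ^ Suc k * p n (x - y)"
          by (rule mult_left_mono) simp
        with False show ?thesis by simp
      qed
      have "(\<lambda>k. if n \<le> k + n then (1/2::real) ^ Suc (k + n - n) else 0) sums 1"
        using geo by simp
      then have tail: "(\<lambda>k. if n \<le> k then (1/2::real) ^ Suc (k - n) else 0) sums 1"
        by (subst (asm) sums_iff_shift) simp
      have "(\<lambda>k. (1/2) ^ Suc k * p n (x - y)
              + (1/2) ^ n * (if n \<le> k then (1/2) ^ Suc (k - n) else 0)) sums
              (1 * p n (x - y) + (1/2) ^ n * 1)"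
        by (intro sums_add sums_mult sums_mult2 geo tail)
      then have "d x y \<le> p n (x - y) + (1/2) ^ n"
        unfolding 1 seminorm_dist_def
        using suminf_le[OF split summable_seminorm_dist] by (simp add: sums_iff)
      with n small show ?thesis by linarith
    qed
    then show thesis using e by (intro that[of "e / 2" n]) auto
  next
    case 2
    with e show thesis by (intro that[of e 0]) auto
  qed
qed

text \<open>A nontrivial subspace contains a line, which has at least as many points as \<open>\<real>\<close>.\<close>

lemma uncountable_subspace:
  assumes "subspace M" "v \<in> M" "v \<noteq> 0"
  shows "uncountable M"
proof
  assume "countable M"
  moreover have "(\<lambda>t. scale (of_real t) v) ` (UNIV :: real set) \<subseteq> M"
    using assms(1,2) by (auto intro: subspace_scale)
  ultimately have "countable ((\<lambda>t. scale (of_real t) v) ` (UNIV :: real set))"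
    by (rule countable_subset[rotated])
  moreover have "inj (\<lambda>t::real. scale (of_real t) v)"
    using assms(3) by (auto intro: injI)
  ultimately show False
    using countable_image_inj_on uncountable_UNIV_real by blast
qed

end

text \<open>
  The manifold itself serves as the scrambled set: the difference of two of its points is again one
  of its points, and irregularity of that difference is chaotic behaviour of the pair.
\<close>

lemma (in operator_family) irregular_manifold_imp_chaotic:
  assumes d: "standard_dist pY dY"
    and M: "uniformly_distr_irregular_manifold sX pY N T M"
    and dense: "dense_in (seminorm_topology pX) M"
  shows "densely_distr_chaotic pX dY N T"
proof -
  have sub: "X.subspace M" and "M \<noteq> {0}"
    using M by (auto simp: uniformly_distr_irregular_manifold_def)
  then obtain v where v: "v \<in> M" "v \<noteq> 0" using X.subspace_0 by blast
  obtain m where m: "\<And>x. x \<in> M - {0} \<Longrightarrow> distr_m_unbounded pY N T m x \<and> distr_near_zero pY N T x"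
    using M unfolding uniformly_distr_irregular_manifold_def by blast
  have all: "upper_density (\<Inter>j\<in>{1..N}. D j) = 1"
    if A: "upper_density A = 1" and "\<And>j. j \<in> {1..N} \<Longrightarrow> eventually (\<lambda>k. k \<in> D j) (along A)"
    for A D
  proof (rule upper_density_1_if_eventually_along[OF A])
    show "eventually (\<lambda>k. k \<in> (\<Inter>j\<in>{1..N}. D j)) (along A)"
      using that(2) by (simp add: eventually_ball_finite)
  qed
  have diff: "eventually (\<lambda>k. T j k x - T j k y = T j k (x - y)) (along A)" if "j \<in> {1..N}" for j x y A
    unfolding eventually_along using T_diff[OF that] by metis
  have "upper_density (\<Inter>j\<in>{1..N}. {k. dY (T j k x) (T j k y) \<ge> (1/2) ^ (m + 2)}) = 1 \<and>
        upper_density (\<Inter>j\<in>{1..N}. {k. dY (T j k x) (T j k y) < \<epsilon>}) = 1"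
    if "\<epsilon> > 0" "x \<in> M" "y \<in> M" "x \<noteq> y" for \<epsilon> x y
  proof
    have "x - y \<in> M - {0}" using that X.subspace_diff[OF sub] by simp
    from m[OF this] obtain A B where
      B: "upper_density B = 1"
         "\<And>j. j \<in> {1..N} \<Longrightarrow> filterlim (\<lambda>k. pY m (T j k (x - y))) at_top (along B)" and
      A: "upper_density A = 1"
         "\<And>j. j \<in> {1..N} \<Longrightarrow> limitin (seminorm_topology pY) (\<lambda>k. T j k (x - y)) 0 (along A)"
      unfolding distr_m_unbounded_def distr_near_zero_def by blast
    show "upper_density (\<Inter>j\<in>{1..N}. {k. dY (T j k x) (T j k y) \<ge> (1/2) ^ (m + 2)}) = 1"
    proof (rule all[OF B(1)])
      fix j assume j: "j \<in> {1..N}"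
      have "eventually (\<lambda>k. 1 \<le> pY m (T j k (x - y))) (along B)"
        using B(2)[OF j] unfolding filterlim_at_top by blast
      with diff[OF j, of x y B]
      show "eventually (\<lambda>k. k \<in> {k. dY (T j k x) (T j k y) \<ge> (1/2) ^ (m + 2)}) (along B)"
        by eventually_elim (use Y.standard_dist_ge[OF d] in simp)
    qed
    obtain n c where c: "c > 0" "\<And>x y. pY n (x - y) < c \<Longrightarrow> dY x y < \<epsilon>"
      by (rule Y.standard_dist_less[OF d \<open>\<epsilon> > 0\<close>]) (rule that)
    show "upper_density (\<Inter>j\<in>{1..N}. {k. dY (T j k x) (T j k y) < \<epsilon>}) = 1"
    proof (rule all[OF A(1)])
      fix j assume j: "j \<in> {1..N}"
      have "eventually (\<lambda>k. pY n (T j k (x - y) - 0) < c) (along A)"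
        using A(2)[OF j] c(1) unfolding Y.limitin_seminorm_iff by blast
      with diff[OF j, of x y A]
      show "eventually (\<lambda>k. k \<in> {k. dY (T j k x) (T j k y) < \<epsilon>}) (along A)"
        by eventually_elim (use c(2) in simp)
    qed
  qed
  moreover have "uncountable M" by (rule X.uncountable_subspace[OF sub v])
  moreover have "(1/2::real) ^ (m + 2) > 0" by simp
  ultimately show ?thesis
    unfolding densely_distr_chaotic_def using dense by blast
qed

section \<open>Dense manifolds of irregular vectors\<close>

theorem theorem4p3:
  fixes sX :: "'k::real_normed_field \<Rightarrow> 'x::ab_group_add \<Rightarrow> 'x"
    and pX :: "nat \<Rightarrow> 'x \<Rightarrow> real"
    and sY :: "'k \<Rightarrow> 'y::ab_group_add \<Rightarrow> 'y"
    and pY :: "nat \<Rightarrow> 'y \<Rightarrow> real"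
    and dY :: "'y \<Rightarrow> 'y \<Rightarrow> real"
    and N :: nat
    and T :: "nat \<Rightarrow> nat \<Rightarrow> 'x \<Rightarrow> 'y"
    and X0 :: "'x set"
  assumes "frechet_space sX pX" and "\<exists>x::'x. x \<noteq> 0"
    and "frechet_space sY pY" and "\<exists>y::'y. y \<noteq> 0"
    and "standard_dist pY dY"
    and "separable_space (seminorm_topology pX)"
    and "module.subspace sX X0" and "dense_in (seminorm_topology pX) X0"
    and "N \<ge> 2"
    and "\<And>j k. j \<in> {1..N} \<Longrightarrow> k \<ge> 1 \<Longrightarrow> T j k \<in> continuous_linear_operators sX pX sY pY"
    and "\<And>x j. x \<in> X0 \<Longrightarrow> j \<in> {1..N} \<Longrightarrow>
           limitin (seminorm_topology pY) (\<lambda>k. T j k x) 0 sequentially"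
    and "\<exists>x. distr_unbounded pY N T x"
  shows "(\<exists>M. uniformly_distr_irregular_manifold sX pY N T M \<and>
              dense_in (seminorm_topology pX) M) \<and>
         densely_distr_chaotic pX dY N T"
proof -
  interpret operator_family sX pX sY pY N T
    using assms(1,3,10) by (intro operator_family.intro operator_family_axioms.intro)
  obtain x m where "distr_m_unbounded pY N T m x"
    using assms(12) unfolding distr_unbounded_def by blast
  then obtain y n G where "block_sequence sX pX sY pY N T m y n G"
    using block_sequence_exists[OF _ assms(8,11)] by blast
  then interpret block_sequence sX pX sY pY N T m y n G .
  obtain C where C: "countable C" "dense_in (seminorm_topology pX) C"
    using assms(6) unfolding separable_space_def dense_in_def by blast
  obtain z where z: "\<And>k. z k \<in> X0"
    and dense: "dense_in (seminorm_topology pX) (X.span (range (\<lambda>k. z k + series (row (Suc k)))))"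
      (is "dense_in _ ?M")
    using dense_span_generators[OF C assms(8)] by blast
  have "?M \<noteq> {0}"
  proof
    assume M: "?M = {0}"
    obtain v :: 'x where "v \<noteq> 0" using assms(2) by blast
    then obtain l where "pX l v \<noteq> 0" using X.seminorm_separating by blast
    then have "pX l v > 0" using X.p_nonneg[of l v] by linarith
    with dense obtain u where "u \<in> ?M" "pX l (u - v) < pX l v"
      unfolding X.dense_in_seminorm_iff by blast
    with M show False by simp
  qed
  then have "uniformly_distr_irregular_manifold sX pY N T ?M"
    unfolding uniformly_distr_irregular_manifold_def
    using span_generators_irregular[where z = z, OF assms(7) z assms(11)] X.subspace_span
    by blast
  with dense irregular_manifold_imp_chaotic[OF assms(5)] show ?thesis by blast
qed

end
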